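(* Let $X$ be a mean-zero Gaussian random vector in $\mathbb{R}^d$ with positive-definite covariance matrix $\Sigma$, and let $\mathcal{C}\subset\mathbb{R}^d$ be a closed convex set that does not contain the origin, has at least one extreme point, and has non-empty interior. Let $(a_n)$ be a real sequence with $a_n\to\infty$ as $n\to\infty$. Then $$\lim_{n\to\infty}\frac{1}{a_n^2}\log\mathbb{P}\left(\delta_{\mathcal{C}}\left(\frac{X}{a_n}\right)\ge0\right)=-\frac12\left\langle x^*,\Sigma^{-1}x^*\right\rangle,$$ where $x^*=\arg\inf_{x\in\mathcal{C}}\langle x,\Sigma^{-1}x\rangle$.
   Context: For a set $\mathcal{C}\subset\mathbb{R}^d$, $\delta_{\mathcal{C}}(x)=0$ if $x\in\mathcal{C}$ and $\delta_{\mathcal{C}}(x)=-\infty$ if $x\notin\mathcal{C}$, so the event $\{\delta_{\mathcal{C}}(Y)\ge0\}$ is $\{Y\in\mathcal{C}\}$. *)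

theory Defs
  imports "HOL-Probability.Probability"
begin

definition concave_indicator :: "'a set \<Rightarrow> 'a \<Rightarrow> ereal" where
  "concave_indicator C x = (if x \<in> C then 0 else - \<infinity>)"

definition positive_definite :: "real ^ 'n ^ 'n \<Rightarrow> bool" where
  "positive_definite S \<longleftrightarrow> transpose S = S \<and> (\<forall>x. x \<noteq> 0 \<longrightarrow> x \<bullet> (S *v x) > 0)"

definition multivariate_normal_density ::
    "real ^ 'n \<Rightarrow> real ^ 'n ^ 'n \<Rightarrow> real ^ 'n \<Rightarrow> real" where
  "multivariate_normal_density \<mu> S x =
     exp (- ((x - \<mu>) \<bullet> (matrix_inv S *v (x - \<mu>))) / 2) /
     sqrt ((2 * pi) ^ CARD('n) * det S)"

(* Only the nondegenerate case is covered: the density characterises the normal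
   law with mean \<mu> and covariance matrix S when S is positive definite. *)
definition gaussian_vector ::
    "'a measure \<Rightarrow> ('a \<Rightarrow> real ^ 'n) \<Rightarrow> real ^ 'n \<Rightarrow> real ^ 'n ^ 'n \<Rightarrow> bool" where
  "gaussian_vector M X \<mu> S \<longleftrightarrow>
     positive_definite S \<and>
     distributed M lborel X (\<lambda>x. ennreal (multivariate_normal_density \<mu> S x))"

end

theory Submission
  imports Defs
begin

text \<open>
  Write \<open>Q x = \<langle>x, \<Sigma>\<inverse> x\<rangle>\<close>. The first-order condition at the minimiser \<open>x\<^sub>0\<close> gives
  \<open>Q x \<ge> s\<^sup>2 Q x\<^sub>0 + Q (x - s x\<^sub>0)\<close> on \<open>s C\<close>, so there the Gaussian density is at most
  \<open>exp (- s\<^sup>2 Q x\<^sub>0 / 2)\<close> times its own translate, and integrating gives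
  \<open>P (X / s \<in> C) \<le> exp (- s\<^sup>2 Q x\<^sub>0 / 2)\<close>. Conversely \<open>x\<^sub>0\<close> lies in the closure of the interior
  of \<open>C\<close>, so for every \<open>k > Q x\<^sub>0\<close> some ball in \<open>C\<close> has \<open>Q < k\<close>; the dilates of this ball
  have volume bounded below and density at least \<open>exp (- s\<^sup>2 k / 2) / Z\<close>.
\<close>

section \<open>Positive definite matrices and their quadratic forms\<close>

lemma positive_definite_inner_commute:
  assumes "positive_definite A"
  shows "x \<bullet> (A *v y) = y \<bullet> (A *v x)"
proof -
  have "x v* A = A *v x"
    using assms transpose_matrix_vector[of A x] by (simp add: positive_definite_def)
  then show ?thesis
    using dot_lmul_matrix[of x A y] by (simp add: inner_commute)
qed

lemma positive_definite_nonneg: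
  assumes "positive_definite A"
  shows "0 \<le> x \<bullet> (A *v x)"
  using assms unfolding positive_definite_def
  by (cases "x = 0") (auto intro: less_imp_le)

text \<open>With \<open>u = matrix_inv S *v x\<close>, the form of the inverse at \<open>x\<close>
  is the form of \<open>S\<close> at \<open>u\<close>, which transfers positivity. Since
  \<open>positive_definite\<close> includes symmetry, the symmetry of the inverse has to be
  transferred as well.\<close>

lemma positive_definite_matrix_inv:
  fixes S :: "real ^ 'n ^ 'n"
  assumes S: "positive_definite S"
  shows "positive_definite (matrix_inv S)"
proof -
  let ?A = "matrix_inv S"
  have "inj ((*v) S)"
  proof (rule injI)
    fix x y assume "S *v x = S *v y"
    then have "(x - y) \<bullet> (S *v (x - y)) = 0"
      by (simp add: matrix_vector_mult_diff_distrib)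
    then have "x - y = 0"
      using S less_irrefl unfolding positive_definite_def by metis
    then show "x = y" by simp
  qed
  then have "invertible S"
    by (simp add: invertible_left_inverse matrix_left_invertible_injective)
  then have SA: "S ** ?A = mat 1"
    unfolding invertible_def matrix_inv_def by (metis (mono_tags, lifting) someI_ex)
  then have S_A: "S *v (?A *v x) = x" for x
    by (simp add: matrix_vector_mul_assoc)
  \<comment> \<open>Writing \<open>x\<close> as \<open>S *v (?A *v x)\<close> puts \<open>S\<close>
    between the two vectors, where its symmetry lets them be exchanged.\<close>
  have eq: "x \<bullet> (?A *v y) = (?A *v x) \<bullet> (S *v (?A *v y))" for x y
    using positive_definite_inner_commute[OF S, of "?A *v x" "?A *v y"]
    by (simp add: S_A inner_commute)
  have "x \<bullet> (?A *v y) = (?A *v x) \<bullet> y" for x y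
    using eq[of x y] by (simp add: S_A)
  then have "x v* ?A = ?A *v x" for x
    using vector_eq_rdot[of "x v* ?A" "?A *v x"] by (simp add: dot_lmul_matrix)
  then have "transpose ?A = ?A"
    by (simp add: matrix_eq)
  moreover have "0 < x \<bullet> (?A *v x)" if "x \<noteq> 0" for x
  proof -
    have "?A *v x \<noteq> 0" using that S_A[of x] by (metis matrix_vector_mult_0_right)
    then show ?thesis using S eq[of x x] by (simp add: positive_definite_def)
  qed
  ultimately show ?thesis by (simp add: positive_definite_def)
qed

lemma continuous_on_quadratic_form:
  fixes A :: "real ^ 'n ^ 'm"
  assumes "continuous_on T f" "continuous_on T g"
  shows "continuous_on T (\<lambda>x. f x \<bullet> (A *v g x))"
  using assms by (intro continuous_intros continuous_on_compose2[OF matrix_vector_mult_linear_continuous_on]) auto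

lemma quadratic_form_add:
  assumes "positive_definite A"
  shows "(x + y) \<bullet> (A *v (x + y)) = x \<bullet> (A *v x) + 2 * (x \<bullet> (A *v y)) + y \<bullet> (A *v y)"
  using positive_definite_inner_commute[OF assms, of x y]
  by (simp add: inner_add_left inner_add_right matrix_vector_right_distrib)

lemma quadratic_form_scaleR:
  fixes A :: "real ^ 'n ^ 'n"
  shows "(c *\<^sub>R x) \<bullet> (A *v (c *\<^sub>R x)) = c\<^sup>2 * (x \<bullet> (A *v x))"
  by (simp add: power2_eq_square matrix_vector_mult_scaleR)

text \<open>The constant is the minimum of the form on the compact unit sphere, positive because the
  minimiser is nonzero; homogeneity of degree two extends the bound to all vectors.\<close>

lemma positive_definite_coercive:
  fixes A :: "real ^ 'n ^ 'n"
  assumes "positive_definite A"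
  obtains c where "0 < c" "\<And>x. c * (norm x)\<^sup>2 \<le> x \<bullet> (A *v x)"
proof -
  let ?S = "sphere (0 :: real ^ 'n) 1"
  have ne: "?S \<noteq> {}" by simp
  obtain u where u: "u \<in> ?S" "\<And>x. x \<in> ?S \<Longrightarrow> u \<bullet> (A *v u) \<le> x \<bullet> (A *v x)"
    using continuous_attains_inf[OF compact_sphere ne continuous_on_quadratic_form[OF continuous_on_id continuous_on_id, of ?S A]]
    by auto
  show thesis
  proof (rule that)
    show "0 < u \<bullet> (A *v u)"
      using assms u(1) by (cases "u = 0") (auto simp: positive_definite_def)
    show "u \<bullet> (A *v u) * (norm x)\<^sup>2 \<le> x \<bullet> (A *v x)" for x
    proof (cases "x = 0")
      case False
      have "(norm x)\<^sup>2 * (u \<bullet> (A *v u)) \<le> (norm x)\<^sup>2 * (sgn x \<bullet> (A *v sgn x))"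
        using False by (intro mult_left_mono u) (auto simp: norm_sgn)
      also have "\<dots> = (norm x *\<^sub>R sgn x) \<bullet> (A *v (norm x *\<^sub>R sgn x))"
        by (simp only: quadratic_form_scaleR)
      also have "norm x *\<^sub>R sgn x = x"
        using False by (simp add: sgn_div_norm)
      finally show ?thesis by (simp add: mult.commute)
    qed simp
  qed
qed

section \<open>Minimisers of a quadratic form over closed and convex sets\<close>

lemma quadratic_form_attains_inf:
  fixes A :: "real ^ 'n ^ 'n"
  assumes A: "positive_definite A" and "closed C" "C \<noteq> {}"
  obtains x where "x \<in> C" "\<And>y. y \<in> C \<Longrightarrow> x \<bullet> (A *v x) \<le> y \<bullet> (A *v y)"
proof -
  let ?Q = "\<lambda>x. x \<bullet> (A *v x)"
  obtain c where c: "0 < c" "\<And>x. c * (norm x)\<^sup>2 \<le> ?Q x"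
    using positive_definite_coercive[OF A] by blast
  obtain z where z: "z \<in> C" using \<open>C \<noteq> {}\<close> by blast
  \<comment> \<open>Coercivity bounds this sublevel set, so \<open>K\<close> is compact. A minimiser
    over \<open>K\<close> also minimises over \<open>C\<close>, since points of \<open>C\<close>
    outside \<open>K\<close> have values above \<open>?Q z\<close>.\<close>
  define K where "K = C \<inter> {x. ?Q x \<le> ?Q z}"
  have "K \<subseteq> cball 0 (sqrt (?Q z / c))"
  proof
    fix x assume "x \<in> K"
    then have "c * (norm x)\<^sup>2 \<le> ?Q z" using c(2)[of x] by (auto simp: K_def)
    then have "(norm x)\<^sup>2 \<le> ?Q z / c" using c(1) by (simp add: field_simps)
    then show "x \<in> cball 0 (sqrt (?Q z / c))" by (simp add: real_le_rsqrt)
  qed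
  then have "bounded K" using bounded_subset by blast
  moreover have "closed K" unfolding K_def
    by (intro closed_Int \<open>closed C\<close> closed_Collect_le continuous_on_quadratic_form) auto
  ultimately have "compact K" by (simp add: compact_eq_bounded_closed)
  moreover have "K \<noteq> {}" using z by (auto simp: K_def)
  ultimately obtain x where x: "x \<in> K" "\<And>y. y \<in> K \<Longrightarrow> ?Q x \<le> ?Q y"
    using continuous_attains_inf[OF _ _ continuous_on_quadratic_form[OF continuous_on_id continuous_on_id, of K A]]
    by auto
  show thesis
  proof (rule that)
    show "x \<in> C" using x(1) by (simp add: K_def)
    show "?Q x \<le> ?Q y" if "y \<in> C" for y
      using x(1) x(2)[of y] that by (cases "?Q y \<le> ?Q z") (auto simp: K_def)
  qed
qed

text \<open>On the segment from \<open>x\<close> towards \<open>y\<close> the form changes by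
  \<open>t * (2 * b + t * ?Q d)\<close>. A negative slope \<open>b\<close> would make this negative
  for small \<open>t\<close>, against minimality of \<open>x\<close>.\<close>

lemma quadratic_form_first_order:
  fixes A :: "real ^ 'n ^ 'n"
  assumes A: "positive_definite A" and "convex C" and x: "x \<in> C"
    and min: "\<And>y. y \<in> C \<Longrightarrow> x \<bullet> (A *v x) \<le> y \<bullet> (A *v y)" and y: "y \<in> C"
  shows "x \<bullet> (A *v x) \<le> x \<bullet> (A *v y)"
proof (rule ccontr)
  let ?Q = "\<lambda>x. x \<bullet> (A *v x)"
  define d where "d = y - x"
  define b where "b = x \<bullet> (A *v d)"
  assume "\<not> ?thesis"
  then have b: "b < 0"
    by (simp add: b_def d_def matrix_vector_mult_diff_distrib inner_diff_right)
  have q: "0 \<le> ?Q d" by (rule positive_definite_nonneg[OF A])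
  have *: "0 \<le> 2 * b + t * ?Q d" if "0 < t" "t \<le> 1" for t
  proof -
    have "(1 - t) *\<^sub>R x + t *\<^sub>R y \<in> C"
      using \<open>convex C\<close> x y that by (intro convexD) auto
    then have "?Q x \<le> ?Q (x + t *\<^sub>R d)"
      using min[of "x + t *\<^sub>R d"] by (simp add: d_def algebra_simps)
    also have "\<dots> = ?Q x + t * (2 * b + t * ?Q d)"
      by (simp only: quadratic_form_add[OF A] quadratic_form_scaleR)
        (simp add: b_def matrix_vector_mult_scaleR power2_eq_square algebra_simps)
    finally show ?thesis using that by (simp add: zero_le_mult_iff)
  qed
  \<comment> \<open>This choice gives \<open>t * ?Q d \<le> - b\<close>, so that
    \<open>2 * b + t * ?Q d \<le> b < 0\<close>. The summand 1 keeps the denominator positive when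
    \<open>?Q d = 0\<close>.\<close>
  define t where "t = min 1 (- b / (?Q d + 1))"
  have "0 < t" "t \<le> 1" using b q by (auto simp: t_def divide_neg_pos)
  moreover have "t * ?Q d \<le> - b"
  proof -
    have "t * ?Q d \<le> t * (?Q d + 1)" using \<open>0 < t\<close> by simp
    also have "\<dots> \<le> (- b / (?Q d + 1)) * (?Q d + 1)"
      using q by (intro mult_right_mono) (auto simp: t_def)
    also have "\<dots> = - b" using q by simp
    finally show ?thesis .
  qed
  ultimately show False using *[of t] b by linarith
qed

section \<open>Gaussian probabilities of dilates of a convex set\<close>

lemma nn_integral_lborel_translate:
  fixes c :: "'a :: euclidean_space"
  assumes "f \<in> borel_measurable borel"
  shows "(\<integral>\<^sup>+x. f (x - c) \<partial>lborel) = (\<integral>\<^sup>+x. f x \<partial>lborel)"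
proof -
  have "(\<integral>\<^sup>+x. f x \<partial>lborel) = (\<integral>\<^sup>+x. f x \<partial>distr lborel borel ((+) (- c)))"
    by (simp only: lborel_distr_plus)
  also have "\<dots> = (\<integral>\<^sup>+x. f (x - c) \<partial>lborel)"
    using assms by (subst nn_integral_distr) auto
  finally show ?thesis ..
qed

text \<open>Here \<open>A\<close> plays the role of the inverse covariance matrix and
  \<open>xs\<close> that of the minimiser. The normalising constant \<open>Z\<close> is kept
  abstract; what is needed about it follows from the total mass being 1.\<close>

context
  fixes M :: "'a measure" and X :: "'a \<Rightarrow> real ^ 'n" and A :: "real ^ 'n ^ 'n"
    and Z :: real and C :: "(real ^ 'n) set" and xs :: "real ^ 'n"
  assumes prob: "prob_space M" and A: "positive_definite A"
    and dist: "distributed M lborel X (\<lambda>x. ennreal (exp (- (x \<bullet> (A *v x)) / 2) / Z))"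
    and C: "closed C" "convex C"
    and xs: "xs \<in> C" "\<And>y. y \<in> C \<Longrightarrow> xs \<bullet> (A *v xs) \<le> y \<bullet> (A *v y)"
begin

lemma measurable_scaled [measurable]: "{x. x /\<^sub>R s \<in> C} \<in> sets borel"
proof -
  have "closed ((\<lambda>x. x /\<^sub>R s) -` C)"
    by (intro continuous_closed_vimage C(1) continuous_intros)
  then show ?thesis by (simp add: vimage_def)
qed

lemma emeasure_scaled:
  "emeasure M {\<omega> \<in> space M. X \<omega> /\<^sub>R s \<in> C} =
    (\<integral>\<^sup>+x. ennreal (exp (- (x \<bullet> (A *v x)) / 2) / Z) * indicator {x. x /\<^sub>R s \<in> C} x \<partial>lborel)"
proof -
  have "{\<omega> \<in> space M. X \<omega> /\<^sub>R s \<in> C} = X -` {x. x /\<^sub>R s \<in> C} \<inter> space M" by auto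
  then show ?thesis using distributed_emeasure[OF dist, of "{x. x /\<^sub>R s \<in> C}"] by simp
qed

lemma density_total: "(\<integral>\<^sup>+x. ennreal (exp (- (x \<bullet> (A *v x)) / 2) / Z) \<partial>lborel) = 1"
  using distributed_emeasure[OF dist, of UNIV] prob_space.emeasure_space_1[OF prob] by simp

text \<open>This replaces a proof that the determinant is positive: for \<open>Z \<le> 0\<close> the density would vanish.\<close>
lemma normalizer_pos: "0 < Z"
proof (rule ccontr)
  assume "\<not> 0 < Z"
  then have "ennreal (exp (- (x \<bullet> (A *v x)) / 2) / Z) = 0" for x
    by (intro ennreal_neg) (auto simp: divide_nonneg_nonpos)
  then show False using density_total by simp
qed

text \<open>There is no prefactor because the density translated by \<open>s *\<^sub>R xs\<close>
  still has total mass 1. The bound therefore passes to the logarithmic limit without an error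
  term.\<close>

lemma prob_scaled_le:
  assumes "0 < s"
  shows "measure M {\<omega> \<in> space M. X \<omega> /\<^sub>R s \<in> C} \<le> exp (- s\<^sup>2 * (xs \<bullet> (A *v xs)) / 2)"
proof -
  let ?Q = "\<lambda>x. x \<bullet> (A *v x)"
  define E where "E = exp (- s\<^sup>2 * ?Q xs / 2)"
  have ptw: "exp (- ?Q x / 2) / Z \<le> E * (exp (- ?Q (x - s *\<^sub>R xs) / 2) / Z)"
    if "x /\<^sub>R s \<in> C" for x
  proof -
    have "?Q xs \<le> xs \<bullet> (A *v (x /\<^sub>R s))"
      by (rule quadratic_form_first_order[OF A C(2) xs that])
    then have "s * ?Q xs \<le> s * (xs \<bullet> (A *v (x /\<^sub>R s)))"
      using assms by simp
    also have "\<dots> = xs \<bullet> (A *v x)"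
      using assms by (simp add: matrix_vector_mult_scaleR)
    finally have le: "s\<^sup>2 * ?Q xs \<le> s * (xs \<bullet> (A *v x))"
      using assms by (simp add: power2_eq_square)
    \<comment> \<open>This is the mixed term when \<open>?Q x\<close> is expanded about
      \<open>s *\<^sub>R xs\<close>. By \<open>le\<close> it is nonnegative, so discarding it bounds
      \<open>?Q x\<close> from below.\<close>
    have cross: "(s *\<^sub>R xs) \<bullet> (A *v (x - s *\<^sub>R xs)) = s * (xs \<bullet> (A *v x)) - s\<^sup>2 * ?Q xs"
      by (simp add: matrix_vector_mult_diff_distrib matrix_vector_mult_scaleR inner_diff_right
          right_diff_distrib power2_eq_square)
    have "s\<^sup>2 * ?Q xs + ?Q (x - s *\<^sub>R xs)
        \<le> s\<^sup>2 * ?Q xs + 2 * (s * (xs \<bullet> (A *v x)) - s\<^sup>2 * ?Q xs) + ?Q (x - s *\<^sub>R xs)"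
      using le by (intro add_right_mono) (simp add: mult.commute)
    also have "\<dots> = ?Q (s *\<^sub>R xs + (x - s *\<^sub>R xs))"
      by (simp only: quadratic_form_add[OF A] cross quadratic_form_scaleR)
    also have "s *\<^sub>R xs + (x - s *\<^sub>R xs) = x" by simp
    finally have "s\<^sup>2 * ?Q xs + ?Q (x - s *\<^sub>R xs) \<le> ?Q x" .
    then have "exp (- ?Q x / 2) \<le> exp (- s\<^sup>2 * ?Q xs / 2 + - ?Q (x - s *\<^sub>R xs) / 2)"
      by simp
    then have "exp (- ?Q x / 2) \<le> E * exp (- ?Q (x - s *\<^sub>R xs) / 2)"
      unfolding E_def exp_add .
    then have "exp (- ?Q x / 2) / Z \<le> E * exp (- ?Q (x - s *\<^sub>R xs) / 2) / Z"
      by (rule divide_right_mono) (use normalizer_pos in simp)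
    then show ?thesis by simp
  qed
  have meas: "(\<lambda>x. ennreal (exp (- ?Q x / 2) / Z)) \<in> borel_measurable borel"
    using distributed_borel_measurable[OF dist] by simp
  have "emeasure M {\<omega> \<in> space M. X \<omega> /\<^sub>R s \<in> C}
      \<le> (\<integral>\<^sup>+x. ennreal E * ennreal (exp (- ?Q (x - s *\<^sub>R xs) / 2) / Z) \<partial>lborel)"
    unfolding emeasure_scaled
  proof (rule nn_integral_mono)
    fix x
    have "ennreal (exp (- ?Q x / 2) / Z) \<le> ennreal (E * (exp (- ?Q (x - s *\<^sub>R xs) / 2) / Z))"
      if "x /\<^sub>R s \<in> C" using ptw[OF that] by (rule ennreal_leI)
    \<comment> \<open>Outside the dilate the left side is 0, so the pointwise bound extends to the
      whole space, where the translated density can be integrated completely.\<close>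
    then show "ennreal (exp (- ?Q x / 2) / Z) * indicator {x. x /\<^sub>R s \<in> C} x
        \<le> ennreal E * ennreal (exp (- ?Q (x - s *\<^sub>R xs) / 2) / Z)"
      by (subst ennreal_mult[symmetric])
        (use normalizer_pos in \<open>auto simp: E_def split: split_indicator\<close>)
  qed
  also have "\<dots> = ennreal E * (\<integral>\<^sup>+x. ennreal (exp (- ?Q (x - s *\<^sub>R xs) / 2) / Z) \<partial>lborel)"
    using measurable_compose[OF borel_measurable_diff[OF measurable_ident_sets[OF refl] borel_measurable_const] meas]
    by (intro nn_integral_cmult) simp
  also have "\<dots> = ennreal E"
    using nn_integral_lborel_translate[OF meas, of "s *\<^sub>R xs"] density_total by simp
  finally show ?thesis
    by (simp add: measure_def E_def enn2real_leI)
qed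

text \<open>The constant \<open>c\<close> may depend on \<open>k\<close> but not on
  \<open>s\<close>, so its logarithm is negligible after division by \<open>s\<^sup>2\<close>.
  Letting \<open>k\<close> decrease to the minimum then recovers the sharp exponent.\<close>

lemma prob_scaled_ge:
  assumes "interior C \<noteq> {}" "xs \<bullet> (A *v xs) < k"
  obtains c where "0 < c"
    "\<And>s. 1 \<le> s \<Longrightarrow> c * exp (- s\<^sup>2 * k / 2) \<le> measure M {\<omega> \<in> space M. X \<omega> /\<^sub>R s \<in> C}"
proof -
  let ?Q = "\<lambda>x. x \<bullet> (A *v x)"
  have "open {x. ?Q x < k}"
    by (intro open_Collect_less continuous_on_quadratic_form continuous_intros)
  moreover have "xs \<in> closure (interior C)"
    using xs(1) C assms(1) convex_closure_interior closure_closed by blast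
  ultimately have "interior C \<inter> {x. ?Q x < k} \<noteq> {}"
    using assms(2) by (fastforce simp: closure_iff_nhds_not_empty)
  moreover have "open (interior C \<inter> {x. ?Q x < k})"
    using \<open>open {x. ?Q x < k}\<close> by auto
  ultimately obtain y r where r: "0 < r" "ball y r \<subseteq> interior C \<inter> {x. ?Q x < k}"
    by (meson all_not_in_conv open_contains_ball_eq)
  \<comment> \<open>\<open>v\<close> is the volume of \<open>ball y r\<close>. For
    \<open>1 \<le> s\<close> it bounds the volume of the dilated ball from below, uniformly in
    \<open>s\<close>.\<close>
  define v where "v = unit_ball_vol CARD('n) * r ^ CARD('n)"
  have v: "0 < v" using r by (simp add: v_def)
  show thesis
  proof (rule that[of "v / Z"])
    show "0 < v / Z" using v normalizer_pos by simp
    fix s :: real assume s: "1 \<le> s"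
    have "ennreal (v / Z * exp (- s\<^sup>2 * k / 2))
        \<le> ennreal (exp (- s\<^sup>2 * k / 2) / Z) * emeasure lborel (ball (s *\<^sub>R y) (s * r))"
    proof -
      have "v \<le> unit_ball_vol CARD('n) * (s * r) ^ CARD('n)"
        unfolding v_def using r s by (intro mult_left_mono power_mono) auto
      then have "ennreal v \<le> emeasure lborel (ball (s *\<^sub>R y) (s * r))"
        using r s by (simp add: emeasure_ball ennreal_leI)
      moreover have "ennreal (v / Z * exp (- s\<^sup>2 * k / 2)) = ennreal (exp (- s\<^sup>2 * k / 2) / Z) * ennreal v"
        using v normalizer_pos by (simp flip: ennreal_mult)
      ultimately show ?thesis by (simp add: mult_left_mono)
    qed
    also have "\<dots> = (\<integral>\<^sup>+x. ennreal (exp (- s\<^sup>2 * k / 2) / Z) * indicator (ball (s *\<^sub>R y) (s * r)) x \<partial>lborel)"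
      by (simp add: nn_integral_cmult_indicator)
    also have "\<dots> \<le> emeasure M {\<omega> \<in> space M. X \<omega> /\<^sub>R s \<in> C}"
      unfolding emeasure_scaled
    proof (rule nn_integral_mono)
      fix x
      \<comment> \<open>Division by \<open>s\<close> carries the dilated ball into
        \<open>ball y r\<close>, where \<open>?Q < k\<close>; scaling back multiplies the form by
        \<open>s\<^sup>2\<close>.\<close>
      have *: "x /\<^sub>R s \<in> C \<and> ?Q x \<le> s\<^sup>2 * k" if "x \<in> ball (s *\<^sub>R y) (s * r)"
      proof -
        have x: "x = s *\<^sub>R (x /\<^sub>R s)" using s by simp
        have "s *\<^sub>R y - x = s *\<^sub>R (y - x /\<^sub>R s)" using s by (simp add: scaleR_diff_right)
        then have "norm (s *\<^sub>R y - x) = s * norm (y - x /\<^sub>R s)" using s by simp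
        then have "norm (y - x /\<^sub>R s) < r" using that s by (simp add: dist_norm)
        then have "x /\<^sub>R s \<in> interior C" "?Q (x /\<^sub>R s) < k" using r(2) by (auto simp: subset_iff dist_norm)
        moreover have "?Q x = s\<^sup>2 * ?Q (x /\<^sub>R s)" using quadratic_form_scaleR x by metis
        ultimately show ?thesis using interior_subset by (auto intro: mult_left_mono)
      qed
      show "ennreal (exp (- s\<^sup>2 * k / 2) / Z) * indicator (ball (s *\<^sub>R y) (s * r)) x
          \<le> ennreal (exp (- ?Q x / 2) / Z) * indicator {x. x /\<^sub>R s \<in> C} x"
      proof (cases "x \<in> ball (s *\<^sub>R y) (s * r)")
        case True
        then show ?thesis using * normalizer_pos by (auto intro!: ennreal_leI divide_right_mono)
      next
        case False
        then show ?thesis by simp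
      qed
    qed
    finally show "v / Z * exp (- s\<^sup>2 * k / 2) \<le> measure M {\<omega> \<in> space M. X \<omega> /\<^sub>R s \<in> C}"
      using prob v normalizer_pos
      by (subst (asm) finite_measure.emeasure_eq_measure) (auto simp: prob_space.finite_measure)
  qed
qed

section \<open>Logarithmic asymptotics of the scaled probabilities\<close>

lemma log_prob_scaled_tendsto:
  assumes int: "interior C \<noteq> {}" and a: "filterlim a at_top F"
  shows "((\<lambda>n. 1 / (a n)\<^sup>2 * ln (measure M {\<omega> \<in> space M. X \<omega> /\<^sub>R a n \<in> C}))
    \<longlongrightarrow> - (1 / 2) * (xs \<bullet> (A *v xs))) F" (is "(?f \<longlongrightarrow> ?l) F")
proof (rule order_tendstoI)
  let ?P = "\<lambda>s. measure M {\<omega> \<in> space M. X \<omega> /\<^sub>R s \<in> C}"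
  have a1: "\<forall>\<^sub>F n in F. 1 \<le> a n" using a by (simp add: filterlim_at_top)
  {
    fix l assume "l < ?l"
    \<comment> \<open>The hypothesis on \<open>l\<close> says that \<open>- 2 * l\<close> exceeds
      the minimum of the form, which leaves room for an exponent \<open>k\<close> strictly between
      the two.\<close>
    then obtain k where k: "xs \<bullet> (A *v xs) < k" "l < - k / 2"
      using dense[of "xs \<bullet> (A *v xs)" "- 2 * l"] by auto
    obtain c where c: "0 < c" "\<And>s. 1 \<le> s \<Longrightarrow> c * exp (- s\<^sup>2 * k / 2) \<le> ?P s"
      using prob_scaled_ge[OF int k(1)] by blast
    have "((\<lambda>n. ln c / (a n)\<^sup>2 - k / 2) \<longlongrightarrow> 0 - k / 2) F"
      by (intro tendsto_diff tendsto_const real_tendsto_divide_at_top[OF tendsto_const]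
          filterlim_pow_at_top a) simp
    then have "\<forall>\<^sub>F n in F. l < ln c / (a n)\<^sup>2 - k / 2"
      using k(2) by (intro order_tendstoD) auto
    with a1 show "\<forall>\<^sub>F n in F. l < ?f n"
    proof eventually_elim
      case (elim n)
      have "ln c - (a n)\<^sup>2 * k / 2 = ln (c * exp (- (a n)\<^sup>2 * k / 2))"
        using c(1) by (simp add: ln_mult)
      also have "\<dots> \<le> ln (?P (a n))"
        using c(1) c(2)[OF elim(1)] by (intro ln_mono) (auto intro: less_le_trans[OF mult_pos_pos])
      finally have "(ln c - (a n)\<^sup>2 * k / 2) / (a n)\<^sup>2 \<le> ?f n"
        by (simp add: divide_right_mono)
      moreover have "(ln c - (a n)\<^sup>2 * k / 2) / (a n)\<^sup>2 = ln c / (a n)\<^sup>2 - k / 2"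
        using elim(1) by (simp add: diff_divide_distrib)
      ultimately show ?case using elim(2) by linarith
    qed
  next
    fix u assume "?l < u"
    \<comment> \<open>In the upper estimate this lower bound serves only to make the probability
      positive: \<open>ln\<close> is monotone on positive reals, and its value at 0 is a mere
      convention. Any exponent above the minimum would do.\<close>
    obtain c where c: "0 < c"
      "\<And>s. 1 \<le> s \<Longrightarrow> c * exp (- s\<^sup>2 * (xs \<bullet> (A *v xs) + 1) / 2) \<le> ?P s"
      using prob_scaled_ge[OF int, of "xs \<bullet> (A *v xs) + 1"] by auto
    from a1 show "\<forall>\<^sub>F n in F. ?f n < u"
    proof eventually_elim
      case (elim n)
      have "0 < ?P (a n)"
        using c(1) by (intro less_le_trans[OF _ c(2)[OF elim]]) simp
      then have "ln (?P (a n)) \<le> ln (exp (- (a n)\<^sup>2 * (xs \<bullet> (A *v xs)) / 2))"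
        using prob_scaled_le[of "a n"] elim by (intro ln_mono) auto
      then have "ln (?P (a n)) \<le> - (a n)\<^sup>2 * (xs \<bullet> (A *v xs)) / 2"
        by (simp only: ln_exp)
      then have "ln (?P (a n)) / (a n)\<^sup>2 \<le> (- (a n)\<^sup>2 * (xs \<bullet> (A *v xs)) / 2) / (a n)\<^sup>2"
        by (rule divide_right_mono) simp
      also have "\<dots> = ?l" using elim by simp
      finally show ?case using \<open>?l < u\<close> by simp
    qed
  }
qed

end

theorem lemma1:
  fixes M :: "'a measure"
    and X :: "'a \<Rightarrow> real ^ 'n"
    and \<Sigma> :: "real ^ 'n ^ 'n"
    and C :: "(real ^ 'n) set"
    and a :: "nat \<Rightarrow> real"
    and xstar :: "real ^ 'n"
  assumes "prob_space M"
    and "positive_definite \<Sigma>"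
    and "gaussian_vector M X 0 \<Sigma>"
    and "closed C"
    and "convex C"
    and "0 \<notin> C"
    and "\<exists>x. x extreme_point_of C"
    and "interior C \<noteq> {}"
    and "filterlim a at_top sequentially"
    and "xstar = arg_min_on (\<lambda>x. x \<bullet> (matrix_inv \<Sigma> *v x)) C"
  shows "(\<lambda>n. 1 / (a n)\<^sup>2 *
           ln (measure M {\<omega> \<in> space M. concave_indicator C (X \<omega> /\<^sub>R a n) \<ge> 0}))
         \<longlonglongrightarrow> - (1 / 2) * (xstar \<bullet> (matrix_inv \<Sigma> *v xstar))"
proof -
  let ?A = "matrix_inv \<Sigma>"
  have A: "positive_definite ?A" by (rule positive_definite_matrix_inv) fact
  have dist: "distributed M lborel X
      (\<lambda>x. ennreal (exp (- (x \<bullet> (?A *v x)) / 2) / sqrt ((2 * pi) ^ CARD('n) * det \<Sigma>)))"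
    using assms(3) by (simp add: gaussian_vector_def multivariate_normal_density_def)
  have "C \<noteq> {}" using assms(8) by auto
  \<comment> \<open>\<open>arg_min_on\<close> is a choice operator, so \<open>xstar\<close> is known
    to be a minimiser only once some minimiser is shown to exist.\<close>
  then obtain x where "x \<in> C" "\<And>y. y \<in> C \<Longrightarrow> x \<bullet> (?A *v x) \<le> y \<bullet> (?A *v y)"
    using quadratic_form_attains_inf[OF A assms(4)] by blast
  then have "is_arg_min (\<lambda>x. x \<bullet> (?A *v x)) (\<lambda>x. x \<in> C) x"
    by (simp add: is_arg_min_linorder)
  then have "is_arg_min (\<lambda>x. x \<bullet> (?A *v x)) (\<lambda>x. x \<in> C) xstar"
    unfolding assms(10) arg_min_on_def arg_min_def by (rule someI)
  then have min: "xstar \<in> C" "\<And>y. y \<in> C \<Longrightarrow> xstar \<bullet> (?A *v xstar) \<le> y \<bullet> (?A *v y)"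
    by (auto simp: is_arg_min_linorder)
  have "concave_indicator C y \<ge> 0 \<longleftrightarrow> y \<in> C" for y :: "real ^ 'n"
    by (simp add: concave_indicator_def)
  then show ?thesis
    using log_prob_scaled_tendsto[OF assms(1) A dist assms(4,5) min assms(8,9)] by simp
qed

end
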